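(* Let $X$ be a nonempty locally compact Hausdorff space and let $(Y,d)$ be a metric space with at least two points. The space $MU(X,Y)$ is $\sigma$-compact if and only if one of the following conditions holds: (i) $Y$ is compact and $X$ is discrete; (ii) $Y$ is $\sigma$-compact and $X$ is finite. Moreover, in both cases $MU(X,Y)=Y^X$, and in case (i) the space $MU(X,Y)$ is compact.
   Context: A map (multifunction) $F\colon X\to Y$ assigns to each $x\in X$ a subset $F(x)\subseteq Y$; for $A\subseteq X$ put $F(A)=\bigcup_{x\in A}F(x)$. Maps are identified with their graphs $\{(x,y): y\in F(x)\}$. $F$ is upper semicontinuous if for every $x\in X$ and every open $V\supseteq F(x)$ there is an open $U\ni x$ with $F(U)\subseteq V$. $F$ is usco if it is upper semicontinuous and every $F(x)$ is a nonempty compact set. $F$ is minimal usco if it is usco and its graph does not properly contain the graph of any other usco map from $X$ to $Y$. $MU(X,Y)$ is the set of all minimal usco maps from $X$ to $Y$. Let $K(Y)$ be the set of nonempty compact subsets of $Y$, and $H_d$ the Hausdorff metric on $K(Y)$. On $K(Y)^X$ the topology $\tau_{uc}$ of uniform convergence on compact sets is induced by the uniformity $\mathcal U_{uc}$ with base consisting of the sets $W[K,\varepsilon]=\{(F,G): H_d(F(x),G(x))<\varepsilon \text{ for every } x\in K\}$, where $K\subseteq X$ is compact and $\varepsilon>0$. $MU(X,Y)\subseteq K(Y)^X$ carries the subspace topology of $\tau_{uc}$. A function $f\colon X\to Y$ is identified with the single-valued map $x\mapsto\{f(x)\}$ (same graph); $Y^X$ is the Tychonoff product, and $MU(X,Y)=Y^X$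 is equality as topological spaces under this identification. *)

theory Defs
  imports "HOL-Analysis.Analysis"
begin

text \<open>A multifunction from \<open>'a\<close> to \<open>'b\<close> is a function \<open>'a \<Rightarrow> 'b set\<close>.\<close>

definition graph :: "('a \<Rightarrow> 'b set) \<Rightarrow> ('a \<times> 'b) set" where
  "graph F = {(x, y). y \<in> F x}"

definition upper_semicontinuous :: "('a::topological_space \<Rightarrow> 'b::topological_space set) \<Rightarrow> bool" where
  "upper_semicontinuous F \<longleftrightarrow>
     (\<forall>x V. open V \<and> F x \<subseteq> V \<longrightarrow> (\<exists>U. open U \<and> x \<in> U \<and> (\<Union>u\<in>U. F u) \<subseteq> V))"

definition usco :: "('a::topological_space \<Rightarrow> 'b::topological_space set) \<Rightarrow> bool" where
  "usco F \<longleftrightarrow> upper_semicontinuous F \<and> (\<forall>x. F x \<noteq> {} \<and> compact (F x))"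

definition minimal_usco :: "('a::topological_space \<Rightarrow> 'b::topological_space set) \<Rightarrow> bool" where
  "minimal_usco F \<longleftrightarrow> usco F \<and> \<not> (\<exists>G. usco G \<and> graph G \<subset> graph F)"

definition nonempty_compacts :: "'b::topological_space set set" where
  "nonempty_compacts = {C. C \<noteq> {} \<and> compact C}"

text \<open>The two suprema are over bounded nonempty sets, hence meaningful, only for nonempty bounded
  arguments; below the distance is applied to nonempty compact sets only.\<close>

definition hausdorff_dist :: "'b::metric_space set \<Rightarrow> 'b set \<Rightarrow> real" where
  "hausdorff_dist A B = max (SUP a\<in>A. infdist a B) (SUP b\<in>B. infdist b A)"

definition uc_entourage ::
    "'a set \<Rightarrow> real \<Rightarrow> (('a \<Rightarrow> 'b::metric_space set) \<times> ('a \<Rightarrow> 'b set)) set" where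
  "uc_entourage K \<epsilon> =
     {(F, G). F \<in> (UNIV \<rightarrow> nonempty_compacts) \<and> G \<in> (UNIV \<rightarrow> nonempty_compacts) \<and>
              (\<forall>x\<in>K. hausdorff_dist (F x) (G x) < \<epsilon>)}"

text \<open>The topology on \<open>K(Y)\<^sup>X\<close> induced by the uniformity with base \<^term>\<open>uc_entourage K \<epsilon>\<close>
  (\<open>K\<close> compact, \<open>\<epsilon> > 0\<close>): a set is open iff with each \<open>F\<close> it contains some
  \<open>uc_entourage K \<epsilon> `` {F}\<close>.\<close>

definition uc_topology :: "('a::topological_space \<Rightarrow> 'b::metric_space set) topology" where
  "uc_topology = topology (\<lambda>\<U>. \<U> \<subseteq> (UNIV \<rightarrow> nonempty_compacts) \<and>
     (\<forall>F\<in>\<U>. \<exists>K \<epsilon>. compact K \<and> \<epsilon> > 0 \<and> uc_entourage K \<epsilon> `` {F} \<subseteq> \<U>))"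

lemma openin_uc_topology:
  fixes \<U> :: "('a::topological_space \<Rightarrow> 'b::metric_space set) set"
  shows "openin uc_topology \<U> \<longleftrightarrow> \<U> \<subseteq> (UNIV \<rightarrow> nonempty_compacts) \<and>
     (\<forall>F\<in>\<U>. \<exists>K \<epsilon>. compact K \<and> \<epsilon> > 0 \<and> uc_entourage K \<epsilon> `` {F} \<subseteq> \<U>)"
proof -
  let ?P = "\<lambda>\<U> :: ('a \<Rightarrow> 'b set) set. \<U> \<subseteq> (UNIV \<rightarrow> nonempty_compacts) \<and>
     (\<forall>F\<in>\<U>. \<exists>K \<epsilon>. compact K \<and> \<epsilon> > 0 \<and> uc_entourage K \<epsilon> `` {F} \<subseteq> \<U>)"
  have Int: "?P (S \<inter> T)" if S: "?P S" and T: "?P T" for S T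
  proof (intro conjI ballI)
    show "S \<inter> T \<subseteq> UNIV \<rightarrow> nonempty_compacts" using S by blast
    fix F assume F: "F \<in> S \<inter> T"
    obtain K1 e1 where 1: "compact K1" "e1 > 0" "uc_entourage K1 e1 `` {F} \<subseteq> S"
      using S F by blast
    obtain K2 e2 where 2: "compact K2" "e2 > 0" "uc_entourage K2 e2 `` {F} \<subseteq> T"
      using T F by blast
    have "uc_entourage (K1 \<union> K2) (min e1 e2) \<subseteq> uc_entourage K1 e1 \<inter> (uc_entourage K2 e2 ::
        (('a \<Rightarrow> 'b set) \<times> _) set)"
      by (auto simp: uc_entourage_def)
    then have "uc_entourage (K1 \<union> K2) (min e1 e2) `` {F} \<subseteq> S \<inter> T"
      using 1(3) 2(3) by blast
    then show "\<exists>K \<epsilon>. compact K \<and> \<epsilon> > 0 \<and> uc_entourage K \<epsilon> `` {F} \<subseteq> S \<inter> T"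
      using 1(1,2) 2(1,2) by (intro exI[of _ "K1 \<union> K2"] exI[of _ "min e1 e2"]) auto
  qed
  have Union: "?P (\<Union>\<K>)" if "\<forall>S\<in>\<K>. ?P S" for \<K>
  proof (intro conjI ballI)
    show "\<Union>\<K> \<subseteq> UNIV \<rightarrow> nonempty_compacts" using that by blast
    fix F assume "F \<in> \<Union>\<K>"
    then obtain S where S: "S \<in> \<K>" "F \<in> S" by blast
    have "?P S" using that S(1) by (rule bspec)
    with S(2) obtain K e where "compact K" "e > 0" and sub: "uc_entourage K e `` {F} \<subseteq> S"
      by blast
    moreover have "uc_entourage K e `` {F} \<subseteq> \<Union>\<K>"
      using sub Union_upper[OF S(1)] by (rule subset_trans)
    ultimately show "\<exists>K \<epsilon>. compact K \<and> \<epsilon> > 0 \<and> uc_entourage K \<epsilon> `` {F} \<subseteq> \<Union>\<K>"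
      by (intro exI conjI)
  qed
  have "istopology ?P"
    unfolding istopology_def
    by (rule conjI; (rule allI | rule impI)+; (rule Int | rule Union); assumption)
  then show ?thesis
    unfolding uc_topology_def by (simp only: topology_inverse')
qed

lemma topspace_uc_topology:
  "topspace (uc_topology :: ('a::topological_space \<Rightarrow> 'b::metric_space set) topology) =
     (UNIV \<rightarrow> nonempty_compacts)"
proof (rule subset_antisym)
  show "topspace (uc_topology :: ('a \<Rightarrow> 'b set) topology) \<subseteq> (UNIV \<rightarrow> nonempty_compacts)"
    using openin_topspace[of "uc_topology :: ('a \<Rightarrow> 'b set) topology"] unfolding openin_uc_topology by (rule conjunct1)
  have "uc_entourage {} 1 `` {F} \<subseteq> (UNIV \<rightarrow> nonempty_compacts)" for F :: "'a \<Rightarrow> 'b set"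
    unfolding uc_entourage_def by blast
  then have "openin uc_topology (UNIV \<rightarrow> nonempty_compacts :: ('a \<Rightarrow> 'b set) set)"
    unfolding openin_uc_topology using compact_empty zero_less_one
    by (intro conjI ballI exI subset_refl)
  then show "(UNIV \<rightarrow> nonempty_compacts) \<subseteq> topspace (uc_topology :: ('a \<Rightarrow> 'b set) topology)"
    by (rule openin_subset)
qed

definition MU_topology :: "('a::topological_space \<Rightarrow> 'b::metric_space set) topology" where
  "MU_topology = subtopology uc_topology {F. minimal_usco F}"

lemma topspace_MU_topology: "topspace MU_topology = {F. minimal_usco F}"
  by (auto simp: MU_topology_def topspace_uc_topology minimal_usco_def usco_def
      nonempty_compacts_def)

definition sigma_compact_space :: "'a topology \<Rightarrow> bool" where
  "sigma_compact_space T \<longleftrightarrow>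
     (\<exists>\<K>. countable \<K> \<and> (\<forall>K\<in>\<K>. compactin T K) \<and> \<Union>\<K> = topspace T)"

end

theory Submission
  imports Defs
begin

text \<open>
  If \<open>X\<close> is discrete, shrinking an usco map to a selection keeps it usco, so the minimal usco maps
  are exactly the single-valued ones. Compact sets of \<open>X\<close> are then finite, and
  \<open>hausdorff_dist {a} {b} = dist a b\<close>, so uniform convergence on compact sets is pointwise
  convergence: \<open>MU(X,Y)\<close> is homeomorphic to the Tychonoff power \<open>Y\<^sup>X\<close>
  (\<open>homeomorphic_map_singleton\<close>). Everything about discrete \<open>X\<close> reduces to this power. It is compact
  if \<open>Y\<close> is, it is \<open>\<sigma>\<close>-compact if \<open>X\<close> is finite and \<open>Y\<close> is \<open>\<sigma>\<close>-compact, its factor \<open>Y\<close> is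
  \<open>\<sigma>\<close>-compact whenever the power is, and a diagonal argument shows that an infinite power of a
  noncompact space is never \<open>\<sigma>\<close>-compact.

  What remains is that a non-discrete \<open>X\<close> never gives a \<open>\<sigma>\<close>-compact \<open>MU(X,Y)\<close>
  (\<open>isolated_points_if_sigma_compact_MU\<close>). Near a non-isolated point, inside a compact set \<open>K\<close>, there
  are infinitely many disjoint nonempty open sets \<open>U n\<close>. Each set \<open>A\<close> of natural numbers yields
  a minimal usco map with values in two fixed points \<open>y \<noteq> z\<close>: it is \<open>{y}\<close> on the union of
  the \<open>U n\<close> with \<open>n \<in> A\<close>, \<open>{z}\<close> off the closure of this union, and \<open>{y, z}\<close> on the boundary of the
  closure. For different sets \<open>A\<close> the maps are \<open>{y}\<close> and \<open>{z}\<close> at a common point of some \<open>U n \<subseteq> K\<close>, so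
  their distance on \<open>K\<close> is at least \<open>dist y z\<close>. A family that is uniformly separated on a
  compact set meets each compact set of maps in a finite set, so countably many compact
  sets cannot contain these uncountably many maps.
\<close>

section \<open>The Hausdorff distance of nonempty compact sets\<close>

lemma infdist_le_hausdorff_dist:
  fixes A B :: "'b::metric_space set"
  assumes "compact A" "a \<in> A"
  shows "infdist a B \<le> hausdorff_dist A B"
proof -
  have "compact ((\<lambda>a. infdist a B) ` A)"
    using assms by (intro compact_continuous_image continuous_intros)
  then have "bdd_above ((\<lambda>a. infdist a B) ` A)"
    by (intro bounded_imp_bdd_above compact_imp_bounded)
  then have "infdist a B \<le> (SUP a\<in>A. infdist a B)"
    using assms by (intro cSUP_upper)
  then show ?thesis
    by (simp add: hausdorff_dist_def)
qed

lemma hausdorff_dist_commute: "hausdorff_dist A B = hausdorff_dist B A"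
  by (simp add: hausdorff_dist_def max.commute)

lemma hausdorff_dist_singletons [simp]: "hausdorff_dist {a} {b} = dist a b"
  by (simp add: hausdorff_dist_def infdist_def dist_commute)

lemma hausdorff_dist_le_iff:
  fixes A B :: "'b::metric_space set"
  assumes "A \<in> nonempty_compacts" "B \<in> nonempty_compacts"
  shows "hausdorff_dist A B \<le> r \<longleftrightarrow> (\<forall>a\<in>A. infdist a B \<le> r) \<and> (\<forall>b\<in>B. infdist b A \<le> r)"
proof
  assume "hausdorff_dist A B \<le> r"
  then show "(\<forall>a\<in>A. infdist a B \<le> r) \<and> (\<forall>b\<in>B. infdist b A \<le> r)"
    using assms infdist_le_hausdorff_dist[of A _ B] infdist_le_hausdorff_dist[of B _ A]
    by (fastforce simp: nonempty_compacts_def hausdorff_dist_commute[of B])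
next
  assume "(\<forall>a\<in>A. infdist a B \<le> r) \<and> (\<forall>b\<in>B. infdist b A \<le> r)"
  then show "hausdorff_dist A B \<le> r"
    using assms unfolding hausdorff_dist_def
    by (intro max.boundedI cSUP_least) (auto simp: nonempty_compacts_def)
qed

lemma hausdorff_dist_triangle:
  fixes A B C :: "'b::metric_space set"
  assumes A: "A \<in> nonempty_compacts" and B: "B \<in> nonempty_compacts" and C: "C \<in> nonempty_compacts"
  shows "hausdorff_dist A C \<le> hausdorff_dist A B + hausdorff_dist B C"
proof -
  have one_sided: "infdist a C \<le> hausdorff_dist A B + hausdorff_dist B C"
    if "A \<in> nonempty_compacts" "a \<in> A" for a and A C :: "'b set"
  proof -
    have "infdist a C - hausdorff_dist B C \<le> dist a b" if "b \<in> B" for b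
      using infdist_triangle[of a C b] infdist_le_hausdorff_dist[of B b C] B that
      by (auto simp: nonempty_compacts_def)
    then have "infdist a C - hausdorff_dist B C \<le> infdist a B"
      using B by (auto simp: nonempty_compacts_def infdist_notempty intro!: cINF_greatest)
    also have "\<dots> \<le> hausdorff_dist A B"
      using that by (auto simp: nonempty_compacts_def intro: infdist_le_hausdorff_dist)
    finally show ?thesis by simp
  qed
  show ?thesis
    unfolding hausdorff_dist_le_iff[OF A C]
    using one_sided[OF A, of _ C] one_sided[OF C, of _ A]
    by (simp add: hausdorff_dist_commute[of C B] hausdorff_dist_commute[of B A] add.commute)
qed

lemma hausdorff_dist_pos:
  fixes A B :: "'b::metric_space set"
  assumes "A \<in> nonempty_compacts" "B \<in> nonempty_compacts" "A \<noteq> B"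
  shows "0 < hausdorff_dist A B"
proof -
  have one_sided: "0 < hausdorff_dist A B"
    if "A \<in> nonempty_compacts" "B \<in> nonempty_compacts" "a \<in> A" "a \<notin> B" for a and A B :: "'b set"
  proof -
    have "0 < infdist a B"
      using that by (intro infdist_pos_not_in_closed) (auto simp: nonempty_compacts_def compact_imp_closed)
    also have "\<dots> \<le> hausdorff_dist A B"
      using that by (auto simp: nonempty_compacts_def intro: infdist_le_hausdorff_dist)
    finally show ?thesis .
  qed
  show ?thesis
    using assms one_sided[of A B] one_sided[of B A] by (metis hausdorff_dist_commute subsetI subset_antisym)
qed

lemma hausdorff_ball_subset_open:
  fixes A V :: "'b::metric_space set"
  assumes A: "A \<in> nonempty_compacts" and "open V" "A \<subseteq> V"
  obtains e where "e > 0" "\<And>B. \<lbrakk>B \<in> nonempty_compacts; hausdorff_dist A B < e\<rbrakk> \<Longrightarrow> B \<subseteq> V"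
proof -
  obtain e where e: "e > 0" "(\<Union>a\<in>A. ball a e) \<subseteq> V"
    using compact_subset_open_imp_ball_epsilon_subset[of A V] assms by (auto simp: nonempty_compacts_def)
  have "B \<subseteq> V" if B: "B \<in> nonempty_compacts" "hausdorff_dist A B < e" for B
  proof
    fix b assume "b \<in> B"
    then have "infdist b A < e"
      using infdist_le_hausdorff_dist[of B b A] B
      by (simp add: nonempty_compacts_def hausdorff_dist_commute)
    then obtain a where "a \<in> A" "dist b a < e"
      using A by (auto simp: nonempty_compacts_def infdist_notempty cINF_less_iff)
    then have "b \<in> ball a e" by (simp add: dist_commute)
    with e \<open>a \<in> A\<close> show "b \<in> V" by blast
  qed
  with e that show ?thesis by blast
qed

section \<open>Open and compact sets of maps\<close>

lemma openin_uc_value_subset: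
  fixes V :: "'b::metric_space set" and x :: "'a::topological_space"
  assumes "open V"
  shows "openin uc_topology {F \<in> UNIV \<rightarrow> nonempty_compacts. F x \<subseteq> V}"
  unfolding openin_uc_topology
proof (intro conjI ballI)
  fix F :: "'a \<Rightarrow> 'b set" assume F: "F \<in> {F \<in> UNIV \<rightarrow> nonempty_compacts. F x \<subseteq> V}"
  then obtain e where "e > 0" "\<And>B. \<lbrakk>B \<in> nonempty_compacts; hausdorff_dist (F x) B < e\<rbrakk> \<Longrightarrow> B \<subseteq> V"
    using hausdorff_ball_subset_open[of "F x" V] assms by blast
  then show "\<exists>K e. compact K \<and> e > 0 \<and>
      uc_entourage K e `` {F} \<subseteq> {F \<in> UNIV \<rightarrow> nonempty_compacts. F x \<subseteq> V}"
    by (intro exI[of _ "{x}"] exI[of _ e]) (auto simp: uc_entourage_def)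
qed auto

lemma sigma_compact_spaceE:
  assumes "sigma_compact_space T"
  obtains \<K> where "countable \<K>" "\<And>C. C \<in> \<K> \<Longrightarrow> compactin T C" "\<Union>\<K> = topspace T"
proof -
  obtain \<K> where "countable \<K> \<and> (\<forall>C\<in>\<K>. compactin T C) \<and> \<Union>\<K> = topspace T"
    using assms unfolding sigma_compact_space_def ..
  then show ?thesis by (intro that) auto
qed

text \<open>An entourage of radius \<open>\<delta>/2\<close> contains at most one member of a \<open>\<delta>\<close>-separated family, so every
  subset of such a family is closed. Within a compact set, the family is therefore compact and
  discrete.\<close>

lemma separated_subset_of_compactin_uc_finite:
  fixes S :: "('a::topological_space \<Rightarrow> 'b::metric_space set) set"
  assumes C: "compactin uc_topology C" "S \<subseteq> C" and K: "compact K" and "\<delta> > 0"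
    and sep: "\<And>F G. \<lbrakk>F \<in> S; G \<in> S; F \<noteq> G\<rbrakk> \<Longrightarrow> \<exists>x\<in>K. \<delta> \<le> hausdorff_dist (F x) (G x)"
  shows "finite S"
proof -
  have S_sub: "S \<subseteq> UNIV \<rightarrow> nonempty_compacts"
    using compactin_subset_topspace[OF C(1)] C(2) by (auto simp: topspace_uc_topology)
  have closed: "closedin uc_topology T" if T: "T \<subseteq> S" for T
    unfolding closedin_def topspace_uc_topology openin_uc_topology
  proof (intro conjI ballI)
    show "T \<subseteq> UNIV \<rightarrow> nonempty_compacts" using T S_sub by blast
    fix F assume F: "F \<in> (UNIV \<rightarrow> nonempty_compacts) - T"
    have at_most_one: "G = H"
      if "G \<in> T" "H \<in> T" "(F, G) \<in> uc_entourage K (\<delta>/2)"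
        "(F, H) \<in> uc_entourage K (\<delta>/2)" for G H
    proof (rule ccontr)
      assume "G \<noteq> H"
      then obtain x where x: "x \<in> K" "\<delta> \<le> hausdorff_dist (G x) (H x)"
        using sep T \<open>G \<in> T\<close> \<open>H \<in> T\<close> by blast
      have nc: "F x \<in> nonempty_compacts" "G x \<in> nonempty_compacts" "H x \<in> nonempty_compacts"
        using F S_sub T that by (auto simp: Pi_iff)
      have "hausdorff_dist (G x) (F x) < \<delta>/2" "hausdorff_dist (F x) (H x) < \<delta>/2"
        using that x(1) by (auto simp: uc_entourage_def hausdorff_dist_commute)
      with x(2) hausdorff_dist_triangle[OF nc(2,1,3)] show False by linarith
    qed
    show "\<exists>L e. compact L \<and> e > 0 \<and> uc_entourage L e `` {F} \<subseteq> (UNIV \<rightarrow> nonempty_compacts) - T"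
    proof (cases "\<exists>G\<in>T. (F, G) \<in> uc_entourage K (\<delta>/2)")
      case False
      then show ?thesis
        using K \<open>\<delta> > 0\<close> by (intro exI[of _ K] exI[of _ "\<delta>/2"]) (auto simp: uc_entourage_def)
    next
      case True
      then obtain G where G: "G \<in> T" "(F, G) \<in> uc_entourage K (\<delta>/2)" by blast
      with F obtain x where x: "F x \<noteq> G x" by (metis DiffD2 ext)
      \<comment> \<open>The one member \<open>G\<close> of \<open>T\<close> near \<open>F\<close> is cut off by a point where the two maps differ.\<close>
      define e where "e = min (\<delta>/2) (hausdorff_dist (F x) (G x))"
      have e: "e > 0"
        using hausdorff_dist_pos[of "F x" "G x"] x G \<open>\<delta> > 0\<close> by (auto simp: e_def uc_entourage_def Pi_iff)
      have "H \<notin> T" if "(F, H) \<in> uc_entourage (insert x K) e" for H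
      proof
        assume "H \<in> T"
        have "(F, H) \<in> uc_entourage K (\<delta>/2)" using that by (auto simp: uc_entourage_def e_def)
        then have "H = G" using at_most_one G \<open>H \<in> T\<close> by blast
        with that show False by (auto simp: uc_entourage_def e_def)
      qed
      then show ?thesis
        using K e by (intro exI[of _ "insert x K"] exI[of _ e]) (auto simp: uc_entourage_def)
    qed
  qed auto
  have "closedin (subtopology uc_topology S) T" if "T \<subseteq> S" for T
    using closed[OF that] that by (auto simp: closedin_subtopology)
  then have "openin (subtopology uc_topology S) T" if "T \<subseteq> S" for T
    using that S_sub
    by (metis Diff_subset inf.absorb2 inf.absorb_iff2 openin_closedin_eq topspace_subtopology topspace_uc_topology)
  then have "subtopology uc_topology S = discrete_topology S"
    using S_sub by (metis discrete_topology_unique empty_subsetI insert_subset topspace_subtopology_subset topspace_uc_topology)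
  moreover have "compactin uc_topology S"
    using closed_compactin[OF C closed] by blast
  ultimately show "finite S"
    by (metis compact_space_discrete_topology compact_space_subtopology)
qed

section \<open>Non-discrete domains\<close>

text \<open>For disjoint open \<open>P\<close> and \<open>Q\<close>, the graph of this map is the closure of the graph that is
  constantly \<open>y\<close> on \<open>P\<close> and constantly \<open>z\<close> on \<open>Q\<close>.\<close>

definition two_valued :: "'b \<Rightarrow> 'b \<Rightarrow> 'a::topological_space set \<Rightarrow> 'a set \<Rightarrow> 'a \<Rightarrow> 'b set" where
  "two_valued y z P Q x = {v. v = y \<and> x \<in> closure P \<or> v = z \<and> x \<in> closure Q}"

lemma two_valued_commute: "two_valued y z P Q = two_valued z y Q P"
  by (auto simp: two_valued_def fun_eq_iff)

lemma two_valued_eq_singleton: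
  assumes "open P" "P \<inter> Q = {}" "x \<in> P"
  shows "two_valued y z P Q x = {y}"
  using assms closure_subset[of P] open_Int_closure_eq_empty[of P Q]
  by (auto simp: two_valued_def)

lemma usco_two_valued:
  fixes y z :: "'b::t1_space"
  assumes "closure P \<union> closure Q = UNIV"
  shows "usco (two_valued y z P Q)"
  unfolding usco_def upper_semicontinuous_def
proof (intro conjI allI impI)
  fix x
  show "two_valued y z P Q x \<noteq> {}"
    using assms by (auto simp: two_valued_def)
  have "two_valued y z P Q x \<subseteq> {y, z}" by (auto simp: two_valued_def)
  then show "compact (two_valued y z P Q x)"
    by (meson finite.emptyI finite.insertI finite_imp_compact finite_subset)
next
  fix x V assume V: "open V \<and> two_valued y z P Q x \<subseteq> V"
  define U where "U = (if y \<in> V then UNIV else - closure P) \<inter> (if z \<in> V then UNIV else - closure Q)"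
  have "open U" by (auto simp: U_def)
  moreover have "x \<in> U" "(\<Union>u\<in>U. two_valued y z P Q u) \<subseteq> V"
    using V by (auto simp: U_def two_valued_def split: if_splits)
  ultimately show "\<exists>U. open U \<and> x \<in> U \<and> (\<Union>u\<in>U. two_valued y z P Q u) \<subseteq> V" by blast
qed

text \<open>A smaller usco map cannot drop the value \<open>y\<close> at a point of the closure of \<open>P\<close>: it would then
  avoid \<open>y\<close> on a neighbourhood, which meets \<open>P\<close>, where \<open>y\<close> is the only value available.\<close>

lemma two_valued_value_kept:
  fixes y z :: "'b::t1_space"
  assumes "open P" "P \<inter> Q = {}" and G: "usco G" "\<And>u. G u \<subseteq> two_valued y z P Q u"
    and x: "x \<in> closure P"
  shows "y \<in> G x"
proof (rule ccontr)
  assume "y \<notin> G x"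
  then obtain U where U: "open U" "x \<in> U" "(\<Union>u\<in>U. G u) \<subseteq> - {y}"
    using G(1) unfolding usco_def upper_semicontinuous_def
    by (metis closed_singleton open_Compl subset_Compl_singleton)
  obtain w where w: "w \<in> P" "w \<in> U"
    using x U by (meson closure_iff_nhds_not_empty disjoint_iff subset_refl)
  have "G w \<subseteq> {y}"
    using G(2)[of w] two_valued_eq_singleton[OF assms(1,2) w(1)] by metis
  moreover have "G w \<noteq> {}" using G(1) by (auto simp: usco_def)
  ultimately show False using U(3) w(2) by blast
qed

lemma minimal_usco_two_valued:
  fixes y z :: "'b::t1_space"
  assumes "open P" "open Q" "P \<inter> Q = {}" and cover: "closure P \<union> closure Q = UNIV"
  shows "minimal_usco (two_valued y z P Q)"
  unfolding minimal_usco_def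
proof (intro conjI notI)
  show "usco (two_valued y z P Q)" using cover by (rule usco_two_valued)
  assume "\<exists>G. usco G \<and> graph G \<subset> graph (two_valued y z P Q)"
  then obtain G where G: "usco G" "graph G \<subset> graph (two_valued y z P Q)" by blast
  have sub: "G u \<subseteq> two_valued y z P Q u" for u
    using G(2) by (auto simp: graph_def)
  have "y \<in> G x" if "x \<in> closure P" for x
    using two_valued_value_kept[OF assms(1,3) G(1) sub that] .
  moreover have "z \<in> G x" if "x \<in> closure Q" for x
    using two_valued_value_kept[of Q P G z y x] assms G(1) sub that
    by (auto simp: two_valued_commute[of y z])
  ultimately have "two_valued y z P Q x \<subseteq> G x" for x
    by (auto simp: two_valued_def)
  then show False using G(2) by (auto simp: graph_def)
qed

text \<open>Repeatedly separate the limit point from another point of its current neighbourhood.\<close>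

lemma disjoint_open_sequence_near_limit_point:
  fixes x :: "'a::t2_space"
  assumes x: "x islimpt UNIV" and "open W" "x \<in> W"
  obtains U :: "nat \<Rightarrow> 'a set"
  where "\<And>n. open (U n)" "\<And>n. U n \<noteq> {}" "\<And>n. U n \<subseteq> W" "\<And>m n. m \<noteq> n \<Longrightarrow> U m \<inter> U n = {}"
proof -
  have "\<exists>V. \<forall>n. (open (V n) \<and> x \<in> V n \<and> V n \<subseteq> W) \<and>
      (V (Suc n) \<subseteq> V n \<and> (\<exists>U. open U \<and> U \<noteq> {} \<and> U \<subseteq> V n \<and> U \<inter> V (Suc n) = {}))"
  proof (rule dependent_nat_choice)
    show "\<exists>V. open V \<and> x \<in> V \<and> V \<subseteq> W" using assms by blast
    fix V n assume V: "open V \<and> x \<in> V \<and> V \<subseteq> W"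
    then obtain p where p: "p \<in> V" "p \<noteq> x" by (meson islimptE[OF x])
    obtain A B where "open A" "open B" "p \<in> A" "x \<in> B" "A \<inter> B = {}"
      using hausdorff[OF p(2)] by blast
    then show "\<exists>V'. (open V' \<and> x \<in> V' \<and> V' \<subseteq> W) \<and>
        V' \<subseteq> V \<and> (\<exists>U. open U \<and> U \<noteq> {} \<and> U \<subseteq> V \<and> U \<inter> V' = {})"
      using V p by (intro exI[of _ "B \<inter> V"] conjI exI[of _ "A \<inter> V"]) auto
  qed
  then obtain V where "\<forall>n. (open (V n) \<and> x \<in> V n \<and> V n \<subseteq> W) \<and>
      (V (Suc n) \<subseteq> V n \<and> (\<exists>U. open U \<and> U \<noteq> {} \<and> U \<subseteq> V n \<and> U \<inter> V (Suc n) = {}))" ..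
  then have V: "\<And>n. V n \<subseteq> W" "\<And>n. V (Suc n) \<subseteq> V n"
    and step: "\<And>n. \<exists>U. open U \<and> U \<noteq> {} \<and> U \<subseteq> V n \<and> U \<inter> V (Suc n) = {}"
    by simp_all
  define U where "U n = (SOME U. open U \<and> U \<noteq> {} \<and> U \<subseteq> V n \<and> U \<inter> V (Suc n) = {})" for n
  have U: "open (U n) \<and> U n \<noteq> {} \<and> U n \<subseteq> V n \<and> U n \<inter> V (Suc n) = {}" for n
    unfolding U_def by (rule someI_ex[OF step])
  have "U m \<inter> U n = {}" if "m < n" for m n
  proof -
    have "V n \<subseteq> V (Suc m)" using lift_Suc_antimono_le[of V, OF V(2)] that by (simp add: Suc_le_eq)
    with U[of n] U[of m] show ?thesis by blast
  qed
  then have "U m \<inter> U n = {}" if "m \<noteq> n" for m n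
    using that by (metis Int_commute linorder_neqE_nat)
  moreover have "U n \<subseteq> W" for n using U[of n] V(1)[of n] by blast
  ultimately show ?thesis using U by (intro that[of U]) simp_all
qed

lemma uncountable_nat_sets: "uncountable (UNIV :: nat set set)"
  using Cantors_theorem[of "UNIV :: nat set"] by (auto simp: uncountable_def)

lemma isolated_points_if_sigma_compact_MU:
  fixes y z :: "'b::metric_space" and x :: "'a::t2_space"
  assumes "locally_compact_space (euclidean :: 'a topology)" and "y \<noteq> z"
    and sigma: "sigma_compact_space (MU_topology :: ('a \<Rightarrow> 'b set) topology)"
  shows "\<not> x islimpt UNIV"
proof
  assume "x islimpt UNIV"
  obtain W K where W: "open W" "x \<in> W" "W \<subseteq> K" and K: "compact K"
    using assms(1) unfolding locally_compact_space_def
    by (metis UNIV_I compactin_euclidean_iff open_openin topspace_euclidean)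
  obtain U :: "nat \<Rightarrow> 'a set" where U: "\<And>n. open (U n)" "\<And>n. U n \<noteq> {}" "\<And>n. U n \<subseteq> W"
      "\<And>m n. m \<noteq> n \<Longrightarrow> U m \<inter> U n = {}"
    using disjoint_open_sequence_near_limit_point[OF \<open>x islimpt UNIV\<close> W(1,2)] by metis
  obtain p where p: "\<And>n. p n \<in> U n" using U(2) by (meson ex_in_conv some_in_eq)
  define P where "P A = (\<Union>n\<in>A. U n)" for A
  define F where "F A = two_valued y z (P A) (- closure (P A))" for A
  have open_P: "open (P A)" for A using U(1) by (auto simp: P_def)
  have F_y: "F A (p n) = {y}" if "n \<in> A" for n A
    unfolding F_def
  proof (rule two_valued_eq_singleton[OF open_P])
    show "p n \<in> P A" using that p by (auto simp: P_def)
  qed (use closure_subset[of "P A"] in blast)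
  have F_z: "F A (p n) = {z}" if "n \<notin> A" for n A
  proof -
    have "U n \<inter> U m = {}" if "m \<in> A" for m
      using U(4)[of n m] that \<open>n \<notin> A\<close> by blast
    then have "U n \<inter> P A = {}" by (simp add: P_def Int_UN_distrib)
    then have "p n \<in> - closure (P A)"
      using open_Int_closure_eq_empty[OF U(1)] p by blast
    then show ?thesis
      unfolding F_def two_valued_commute[of y z]
      by (intro two_valued_eq_singleton) (use closure_subset[of "P A"] in auto)
  qed
  have sep: "\<exists>x\<in>K. dist y z \<le> hausdorff_dist (F A x) (F B x)" if neq: "A \<noteq> B" for A B
  proof -
    obtain n where n: "n \<in> A \<longleftrightarrow> n \<notin> B" using neq by blast
    have "p n \<in> K" using p U(3) W(3) by blast
    moreover have "hausdorff_dist (F A (p n)) (F B (p n)) = dist y z"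
      using n by (cases "n \<in> A") (simp_all add: F_y F_z dist_commute)
    ultimately show ?thesis by force
  qed
  have F_minimal: "minimal_usco (F A)" for A
    unfolding F_def
  proof (rule minimal_usco_two_valued[OF open_P])
    show "closure (P A) \<union> closure (- closure (P A)) = UNIV"
      using closure_subset[of "- closure (P A)"] by blast
  qed (use closure_subset[of "P A"] in auto)
  obtain \<K> where \<K>: "countable \<K>" "\<And>C. C \<in> \<K> \<Longrightarrow> compactin MU_topology C"
      "\<Union>\<K> = {F :: 'a \<Rightarrow> 'b set. minimal_usco F}"
    using sigma_compact_spaceE[OF sigma, unfolded topspace_MU_topology] by metis
  have "finite {A. F A \<in> C}" if "C \<in> \<K>" for C
  proof -
    have "compactin uc_topology C"
      using \<K>(2)[OF that] by (auto simp: MU_topology_def compactin_subtopology)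
    then have "finite (F ` {A. F A \<in> C})"
      by (rule separated_subset_of_compactin_uc_finite[where K = K and \<delta> = "dist y z"])
        (use K \<open>y \<noteq> z\<close> in \<open>auto intro!: sep\<close>)
    moreover have "inj_on F {A. F A \<in> C}"
    proof (rule inj_onI, rule ccontr)
      fix A B assume "F A = F B" "A \<noteq> B"
      then obtain n where "n \<in> A \<longleftrightarrow> n \<notin> B" by blast
      with \<open>F A = F B\<close> \<open>y \<noteq> z\<close> F_y[of n] F_z[of n] show False by (metis singleton_inject)
    qed
    ultimately show ?thesis by (rule finite_imageD)
  qed
  then have "countable (\<Union>C\<in>\<K>. {A. F A \<in> C})"
    by (intro countable_UN \<K>(1) countable_finite)
  moreover have "(\<Union>C\<in>\<K>. {A. F A \<in> C}) = UNIV"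
    using \<K>(3) F_minimal by auto
  ultimately show False using uncountable_nat_sets by simp
qed

section \<open>Discrete domains\<close>

lemma usco_singleton_discrete:
  fixes f :: "'a::topological_space \<Rightarrow> 'b::topological_space"
  assumes discrete: "(euclidean :: 'a topology) = discrete_topology UNIV"
  shows "usco (\<lambda>x. {f x})"
proof -
  have "open {x :: 'a}" for x
    using discrete by (metis UNIV_I discrete_topology_unique open_openin)
  then have "\<exists>U. open U \<and> x \<in> U \<and> (\<Union>u\<in>U. {f u}) \<subseteq> V" if "{f x} \<subseteq> V" for x V
    using that by (intro exI[of _ "{x}"]) auto
  then show ?thesis
    by (auto simp: usco_def upper_semicontinuous_def)
qed

text \<open>On a discrete space every selection of an usco map is usco, so a minimal usco map coincides
  with each of its selections.\<close>

lemma minimal_usco_discrete_iff: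
  fixes F :: "'a::topological_space \<Rightarrow> 'b::topological_space set"
  assumes discrete: "(euclidean :: 'a topology) = discrete_topology UNIV"
  shows "minimal_usco F \<longleftrightarrow> (\<exists>f. F = (\<lambda>x. {f x}))"
proof
  assume F: "minimal_usco F"
  then have "\<forall>x. \<exists>v. v \<in> F x" by (auto simp: minimal_usco_def usco_def)
  then obtain f where f: "\<And>x. f x \<in> F x" by metis
  have "\<not> graph (\<lambda>x. {f x}) \<subset> graph F"
    using F usco_singleton_discrete[OF discrete, of f] unfolding minimal_usco_def by blast
  moreover have "graph (\<lambda>x. {f x}) \<subseteq> graph F" using f by (auto simp: graph_def)
  ultimately have "graph (\<lambda>x. {f x}) = graph F" by blast
  then have "F = (\<lambda>x. {f x})" by (auto simp: graph_def set_eq_iff fun_eq_iff)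
  then show "\<exists>f. F = (\<lambda>x. {f x})" by blast
next
  assume "\<exists>f. F = (\<lambda>x. {f x})"
  then obtain f where f: "F = (\<lambda>x. {f x})" by blast
  have "False" if G: "usco G" "graph G \<subset> graph F" for G
  proof -
    have "G x \<subseteq> {f x}" "G x \<noteq> {}" for x using G f by (auto simp: graph_def usco_def)
    then have "G = F" using f by (auto simp: fun_eq_iff subset_singleton_iff)
    with G(2) show False by simp
  qed
  with usco_singleton_discrete[OF discrete] f show "minimal_usco F" by (auto simp: minimal_usco_def)
qed

lemma homeomorphic_map_singleton:
  assumes discrete: "(euclidean :: 'a::topological_space topology) = discrete_topology UNIV"
  shows "homeomorphic_map (product_topology (\<lambda>_::'a. (euclidean :: 'b::metric_space topology)) UNIV)
          MU_topology (\<lambda>f x. {f x})"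
proof -
  let ?P = "product_topology (\<lambda>_::'a. (euclidean :: 'b topology)) UNIV"
  let ?s = "\<lambda>(f :: 'a \<Rightarrow> 'b) x. {f x}"
  have MU_iff: "minimal_usco F \<longleftrightarrow> (\<exists>f. F = ?s f)" for F
    using minimal_usco_discrete_iff[OF discrete] .
  have "continuous_map ?P uc_topology ?s"
    unfolding continuous_map_def topspace_uc_topology
  proof (intro conjI allI impI)
    show "?s \<in> topspace ?P \<rightarrow> UNIV \<rightarrow> nonempty_compacts" by (auto simp: nonempty_compacts_def)
    fix \<U> :: "('a \<Rightarrow> 'b set) set" assume \<U>: "openin uc_topology \<U>"
    show "openin ?P {f \<in> topspace ?P. ?s f \<in> \<U>}"
    proof (subst openin_subopen, intro ballI)
      fix f assume "f \<in> {f \<in> topspace ?P. ?s f \<in> \<U>}"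
      then obtain K e where K: "compact K" "e > 0" "uc_entourage K e `` {?s f} \<subseteq> \<U>"
        using \<U> unfolding openin_uc_topology by blast
      have "finite K"
        using K(1) by (metis compactin_discrete_topology compactin_euclidean_iff discrete)
      \<comment> \<open>Only finitely many coordinates are restricted, so this box is open in the product.\<close>
      define B where "B = Pi\<^sub>E UNIV (\<lambda>x. if x \<in> K then ball (f x) e else UNIV)"
      have "openin ?P B"
        unfolding B_def openin_PiE_gen
        using \<open>finite K\<close> by (auto intro!: disjI2 elim!: finite_subset[rotated])
      moreover have "f \<in> B" using K(2) by (auto simp: B_def)
      moreover have "B \<subseteq> {f \<in> topspace ?P. ?s f \<in> \<U>}"
      proof
        fix g assume g: "g \<in> B"
        have "dist (f x) (g x) < e" if "x \<in> K" for x
          using PiE_mem[OF g[unfolded B_def] UNIV_I, of x] that by simp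
        then have "?s g \<in> \<U>"
          using K(3) by (auto simp: uc_entourage_def nonempty_compacts_def)
        then show "g \<in> {f \<in> topspace ?P. ?s f \<in> \<U>}" by simp
      qed
      ultimately show "\<exists>T. openin ?P T \<and> f \<in> T \<and> T \<subseteq> {f \<in> topspace ?P. ?s f \<in> \<U>}" by blast
    qed
  qed
  then have "continuous_map ?P MU_topology ?s"
    using MU_iff by (auto simp: MU_topology_def continuous_map_in_subtopology)
  moreover have "continuous_map MU_topology ?P (\<lambda>F x. the_elem (F x))"
    unfolding continuous_map_componentwise_UNIV
  proof
    fix x
    show "continuous_map MU_topology euclidean (\<lambda>F :: 'a \<Rightarrow> 'b set. the_elem (F x))"
      unfolding continuous_map_def
    proof (intro conjI allI impI)
      fix V :: "'b set" assume "openin euclidean V"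
      then have "openin uc_topology {F \<in> UNIV \<rightarrow> nonempty_compacts. F x \<subseteq> V}"
        by (simp add: openin_uc_value_subset)
      moreover have "{F \<in> topspace MU_topology. the_elem (F x) \<in> V} =
          {F \<in> UNIV \<rightarrow> nonempty_compacts. F x \<subseteq> V} \<inter> {F. minimal_usco F}"
        by (auto simp: topspace_MU_topology MU_iff nonempty_compacts_def)
      ultimately show "openin MU_topology {F \<in> topspace MU_topology. the_elem (F x) \<in> V}"
        unfolding MU_topology_def openin_subtopology by blast
    qed simp
  qed
  ultimately have "homeomorphic_maps ?P MU_topology ?s (\<lambda>F x. the_elem (F x))"
    by (auto simp: homeomorphic_maps_def topspace_MU_topology MU_iff)
  then show ?thesis by (rule homeomorphic_maps_imp_map)
qed

section \<open>Sigma-compactness of powers\<close>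

lemma sigma_compact_space_continuous_image:
  assumes "sigma_compact_space S" "continuous_map S T f" "f ` topspace S = topspace T"
  shows "sigma_compact_space T"
proof -
  obtain \<K> where \<K>: "countable \<K>" "\<And>C. C \<in> \<K> \<Longrightarrow> compactin S C" "\<Union>\<K> = topspace S"
    using sigma_compact_spaceE[OF assms(1)] by metis
  show ?thesis
    unfolding sigma_compact_space_def
  proof (intro exI[of _ "(`) f ` \<K>"] conjI ballI)
    show "countable ((`) f ` \<K>)" using \<K>(1) by (rule countable_image)
    show "compactin T D" if "D \<in> (`) f ` \<K>" for D
      using that \<K>(2) image_compactin[OF _ assms(2)] by (elim imageE) simp
    show "\<Union> ((`) f ` \<K>) = topspace T"
      unfolding assms(3)[symmetric] \<K>(3)[symmetric] by (rule image_Union[symmetric])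
  qed
qed

lemma compact_space_imp_sigma_compact_space:
  "compact_space T \<Longrightarrow> sigma_compact_space T"
  unfolding sigma_compact_space_def compact_space_def by (rule exI[of _ "{topspace T}"]) auto

lemma sigma_compact_space_finite_power:
  assumes "sigma_compact_space T" "finite I"
  shows "sigma_compact_space (product_topology (\<lambda>_. T) I)"
proof -
  obtain \<K> where \<K>: "countable \<K>" "\<And>C. C \<in> \<K> \<Longrightarrow> compactin T C" "\<Union>\<K> = topspace T"
    using sigma_compact_spaceE[OF assms(1)] by metis
  show ?thesis
    unfolding sigma_compact_space_def
  proof (intro exI[of _ "Pi\<^sub>E I ` (I \<rightarrow>\<^sub>E \<K>)"] conjI ballI)
    show "countable (Pi\<^sub>E I ` (I \<rightarrow>\<^sub>E \<K>))"
      using \<K>(1) assms(2) by (intro countable_image countable_PiE) auto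
    fix B assume "B \<in> Pi\<^sub>E I ` (I \<rightarrow>\<^sub>E \<K>)"
    then obtain c where c: "B = Pi\<^sub>E I c" "c \<in> I \<rightarrow>\<^sub>E \<K>" by blast
    then have "compactin T (c i)" if "i \<in> I" for i
      using PiE_mem[OF c(2) that] \<K>(2) by blast
    with c(1) show "compactin (product_topology (\<lambda>_. T) I) B"
      by (simp add: compactin_PiE)
  next
    show "\<Union> (Pi\<^sub>E I ` (I \<rightarrow>\<^sub>E \<K>)) = topspace (product_topology (\<lambda>_. T) I)"
    proof (intro equalityI subsetI)
      fix f assume "f \<in> topspace (product_topology (\<lambda>_. T) I)"
      then have f: "f \<in> I \<rightarrow>\<^sub>E \<Union>\<K>" using \<K>(3) by simp
      then have "\<forall>i\<in>I. \<exists>C. C \<in> \<K> \<and> f i \<in> C" by blast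
      then obtain c where c: "\<And>i. i \<in> I \<Longrightarrow> c i \<in> \<K> \<and> f i \<in> c i" by metis
      have "f \<in> Pi\<^sub>E I (restrict c I)" "restrict c I \<in> I \<rightarrow>\<^sub>E \<K>" using f c by auto
      then show "f \<in> \<Union> (Pi\<^sub>E I ` (I \<rightarrow>\<^sub>E \<K>))" by blast
    qed (use \<K>(3) in \<open>fastforce simp: PiE_iff\<close>)
  qed
qed

text \<open>If \<open>T\<close> is not compact, then the projection of the \<open>n\<close>-th compact set to the \<open>n\<close>-th of
  countably many coordinates misses a value, and a point that takes all these missing values
  lies in none of the compact sets.\<close>

lemma compact_space_if_sigma_compact_infinite_power:
  assumes "sigma_compact_space (product_topology (\<lambda>_. T) I)" "infinite I"
  shows "compact_space T"
proof (rule ccontr)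
  assume not_compact: "\<not> compact_space T"
  let ?P = "product_topology (\<lambda>_. T) I"
  obtain \<K> where \<K>: "countable \<K>" "\<And>C. C \<in> \<K> \<Longrightarrow> compactin ?P C" "\<Union>\<K> = topspace ?P"
    using sigma_compact_spaceE[OF assms(1)] by metis
  obtain j :: "nat \<Rightarrow> 'a" where j: "inj j" "range j \<subseteq> I"
    using infinite_countable_subset[OF assms(2)] by blast
  define i where "i C = j (to_nat_on \<K> C)" for C
  have i: "inj_on i \<K>" "\<And>C. i C \<in> I"
    using j(2) comp_inj_on[OF inj_on_to_nat_on[OF \<K>(1)] inj_on_subset[OF j(1) subset_UNIV]]
    by (auto simp: i_def[abs_def] comp_def)
  have "\<exists>t. t \<in> topspace T \<and> t \<notin> (\<lambda>f. f (i C)) ` C" if "C \<in> \<K>" for C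
  proof -
    have "compactin T ((\<lambda>f. f (i C)) ` C)"
      using image_compactin[OF \<K>(2)[OF that] continuous_map_product_projection[OF i(2)[of C]]] .
    with not_compact have "(\<lambda>f. f (i C)) ` C \<noteq> topspace T"
      by (metis compact_space_def)
    moreover have "(\<lambda>f. f (i C)) ` C \<subseteq> topspace T"
      using \<open>compactin T _\<close> by (rule compactin_subset_topspace)
    ultimately show ?thesis by blast
  qed
  then obtain t where t: "\<And>C. C \<in> \<K> \<Longrightarrow> t C \<in> topspace T \<and> t C \<notin> (\<lambda>f. f (i C)) ` C" by metis
  obtain t0 where t0: "t0 \<in> topspace T"
    using not_compact by (metis compactin_empty compact_space_def ex_in_conv)
  define g where "g = restrict (\<lambda>k. if k \<in> i ` \<K> then t (inv_into \<K> i k) else t0) I"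
  have "g \<in> topspace ?P"
    using t t0 by (auto simp: g_def inv_into_f_f[OF i(1)])
  then obtain C where "C \<in> \<K>" "g \<in> C" using \<K>(3) by blast
  then have "g (i C) = t C" using i(2) by (simp add: g_def inv_into_f_f[OF i(1)])
  then have "t C \<in> (\<lambda>f. f (i C)) ` C" using \<open>g \<in> C\<close> by (metis imageI)
  with t[OF \<open>C \<in> \<K>\<close>] show False by blast
qed

section \<open>The characterization\<close>

theorem theorem3p10:
  assumes "locally_compact_space (euclidean :: 'a::t2_space topology)"
    and "\<exists>y z :: 'b::metric_space. y \<noteq> z"
  shows
    "(sigma_compact_space (MU_topology :: ('a \<Rightarrow> 'b set) topology) \<longleftrightarrow>
        (compact (UNIV :: 'b set) \<and> (euclidean :: 'a topology) = discrete_topology UNIV) \<or>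
        (sigma_compact_space (euclidean :: 'b topology) \<and> finite (UNIV :: 'a set)))
     \<and>
     ((compact (UNIV :: 'b set) \<and> (euclidean :: 'a topology) = discrete_topology UNIV) \<or>
        (sigma_compact_space (euclidean :: 'b topology) \<and> finite (UNIV :: 'a set)) \<longrightarrow>
        homeomorphic_map (product_topology (\<lambda>_::'a. (euclidean :: 'b topology)) UNIV)
          (MU_topology :: ('a \<Rightarrow> 'b set) topology) (\<lambda>f x. {f x}))
     \<and>
     (compact (UNIV :: 'b set) \<and> (euclidean :: 'a topology) = discrete_topology UNIV \<longrightarrow>
        compact_space (MU_topology :: ('a \<Rightarrow> 'b set) topology))"
proof -
  let ?P = "product_topology (\<lambda>_::'a. (euclidean :: 'b topology)) UNIV"
  let ?MU = "MU_topology :: ('a \<Rightarrow> 'b set) topology"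
  let ?discrete = "(euclidean :: 'a topology) = discrete_topology UNIV"
  let ?s = "\<lambda>(f :: 'a \<Rightarrow> 'b) x. {f x}"
  have hom: "homeomorphic_map ?P ?MU ?s" if ?discrete
    using that by (rule homeomorphic_map_singleton)
  have discreteI: ?discrete if "\<And>x :: 'a. \<not> x islimpt UNIV"
    using that by (metis discrete_topology_unique islimpt_UNIV_iff open_openin topspace_euclidean)
  have finite_discrete: ?discrete if "finite (UNIV :: 'a set)"
    using that by (intro discreteI) (simp add: islimpt_finite)
  have sigma_MU_iff: "sigma_compact_space ?MU \<longleftrightarrow> sigma_compact_space ?P" if discrete: ?discrete
  proof -
    obtain g where "homeomorphic_maps ?P ?MU ?s g"
      using hom[OF discrete] homeomorphic_map_maps by blast
    then have "homeomorphic_map ?MU ?P g"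
      by (meson homeomorphic_maps_map)
    then show ?thesis
      using hom[OF discrete] sigma_compact_space_continuous_image
      by (metis homeomorphic_imp_continuous_map homeomorphic_imp_surjective_map)
  qed
  have compact_MU: "compact_space ?MU" if "compact (UNIV :: 'b set)" ?discrete
  proof -
    have "compact_space ?P"
      using that(1) unfolding compact_space_product_topology by (simp add: compact_space_def)
    then show ?thesis
      using hom[OF that(2)] homeomorphic_compact_space homeomorphic_map_imp_homeomorphic_space by blast
  qed
  have "compact (UNIV :: 'b set) \<and> ?discrete \<or>
      sigma_compact_space (euclidean :: 'b topology) \<and> finite (UNIV :: 'a set)"
    if sigma: "sigma_compact_space ?MU"
  proof -
    have ?discrete
      using isolated_points_if_sigma_compact_MU[OF assms(1) _ sigma] assms(2) discreteI by blast
    with sigma have P: "sigma_compact_space ?P" by (simp add: sigma_MU_iff)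
    show ?thesis
    proof (cases "finite (UNIV :: 'a set)")
      case True
      have "range (\<lambda>f. f x) = (UNIV :: 'b set)" for x :: 'a
        by (rule surjI[of _ "\<lambda>v _. v"]) simp
      then have "sigma_compact_space (euclidean :: 'b topology)"
        using sigma_compact_space_continuous_image[OF P continuous_map_product_projection[OF UNIV_I]]
        by simp
      with True show ?thesis by simp
    next
      case False
      then have "compact (UNIV :: 'b set)"
        using compact_space_if_sigma_compact_infinite_power[OF P] by (simp add: compact_space_def)
      with \<open>?discrete\<close> show ?thesis by simp
    qed
  qed
  moreover have "sigma_compact_space ?MU"
    if "sigma_compact_space (euclidean :: 'b topology)" "finite (UNIV :: 'a set)"
    using sigma_compact_space_finite_power[OF that] sigma_MU_iff finite_discrete that(2) by blast
  ultimately show ?thesis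
    using compact_MU compact_space_imp_sigma_compact_space hom finite_discrete by blast
qed

end
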